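(* Let $(X,\mu)$ be a measure space, let $Y=\{y_1,\ldots,y_n\}$ be a finite set, and let $\alpha: X\times Y\rightarrow\mathbb{R}$ be a positive function. Let $\Omega$, $\omega$, $\beta$, $p$, the integral operator $P:L^2(X,\Omega^2\mu)\to L^2(X,\Omega^2\mu)$ and the $n\times n$ matrix $A$ be derived from $\alpha$ as defined in the context. Assume that: (i) $\alpha(\cdot,y_i)\in L^2(X,\mu)$ for each $y_i\in Y$; (ii) $0<\Omega(x)<\infty$ for all $x\in X$, and $0<\omega(y_i)<\infty$ for all $y_i\in Y$. Then: 1. Let $\lambda\in\mathbb{R}\setminus\{0\}$. Then $\lambda$ is an eigenvalue of $P$ if and only if it is an eigenvalue of $A$. 2. Let $\lambda\in\mathbb{R}\setminus\{0\}$. If $\psi\in L^2(X,\Omega^2\mu)$ is an eigenfunction of $P$ with eigenvalue $\lambda$, then there is a corresponding eigenvector $v\in\mathbb{R}^n$ of $A$ with eigenvalue $\lambda$ such that $$\psi(x)=\frac{1}{\sqrt{\lambda}}\sum_{i=1}^n\beta(x,y_i)\,v[i]$$ (as elements of $L^2(X,\Omega^2\mu)$) and $$v[i]=\frac{1}{\sqrt{\lambda}}\int_X\beta(x,y_i)\,\psi(x)\,\Omega(x)^2\,d\mu(x),\quad i=1,\ldots,n.$$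
   Context: Given a measure space $(X,\mu)$, a finite reference set $Y=\{y_1,\ldots,y_n\}$ and a positive affinity function $\alpha:X\times Y\to\mathbb{R}$, define: - the density $\Omega:X\to\mathbb{R}$ by $\Omega(x)=\sum_{i=1}^n\alpha(x,y_i)$ for all $x\in X$; - the density $\omega:Y\to\mathbb{R}$ by $\omega(y_i)=\left(\int_X\alpha(x,y_i)\,\Omega(x)\,d\mu(x)\right)^{1/2}$ for all $y_i\in Y$; - the normalized affinity $\beta:X\times Y\to\mathbb{R}$ by $\beta(x,y_i)=\dfrac{\alpha(x,y_i)}{\Omega(x)\,\omega(y_i)}$; - the kernel $p:X\times X\to\mathbb{R}$ by $p(x,x')=\sum_{i=1}^n\beta(x,y_i)\,\beta(x',y_i)$. The weighted measure $\Omega^2\mu$ on $X$ is the measure with density $\Omega^2$ with respect to $\mu$, i.e. $d(\Omega^2\mu)(x)=\Omega(x)^2\,d\mu(x)$. Under the assumptions in the claim, $\beta(\cdot,y_i)\in L^2(X,\Omega^2\mu)$ for all $i$ and $p\in L^2(X\times X,\Omega^2\mu\otimes\Omega^2\mu)$. The integral operator $P:L^2(X,\Omega^2\mu)\to L^2(X,\Omega^2\mu)$ is defined by $$(Pf)(x)=\int_X p(x,x')\,f(x')\,\Omega(x')^2\,d\mu(x'),\quad f\in L^2(X,\Omega^2\mu).$$ The $n\times n$ real matrix $A$ is defined by $$A[i,j]=\langle\beta(\cdot,y_i),\beta(\cdot,y_j)\rangle_{L^2(X,\Omega^2\mu)}=\int_X\beta(x,y_i)\,\beta(x,y_j)\,\Omega(x)^2\,d\mu(x),\quad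 i,j=1,\ldots,n.$$ The $L^2$ spaces consist of real-valued functions. Eigenfunctions and eigenvectors are nonzero; $v[i]$ denotes the $i$-th coordinate of $v\in\mathbb{R}^n$. *)

theory Defs
  imports "HOL-Analysis.Bochner_Integration" "Jordan_Normal_Form.Char_Poly"
begin

unbundle no vec_syntax

text \<open>
  Elements of \<open>L\<^sup>2\<close> are represented by functions; equality in \<open>L\<^sup>2 M\<close> is equality \<open>AE x in M\<close>.
\<close>

definition L2 :: "'a measure \<Rightarrow> ('a \<Rightarrow> real) set" where
  "L2 M = {f \<in> borel_measurable M. integrable M (\<lambda>x. (f x)\<^sup>2)}"

definition L2_eigenfunction ::
    "'a measure \<Rightarrow> (('a \<Rightarrow> real) \<Rightarrow> 'a \<Rightarrow> real) \<Rightarrow> ('a \<Rightarrow> real) \<Rightarrow> real \<Rightarrow> bool" where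
  "L2_eigenfunction M T f lam \<longleftrightarrow>
     f \<in> L2 M \<and> \<not> (AE x in M. f x = 0) \<and> (AE x in M. T f x = lam * f x)"

definition L2_eigenvalue ::
    "'a measure \<Rightarrow> (('a \<Rightarrow> real) \<Rightarrow> 'a \<Rightarrow> real) \<Rightarrow> real \<Rightarrow> bool" where
  "L2_eigenvalue M T lam \<longleftrightarrow> (\<exists>f. L2_eigenfunction M T f lam)"

text \<open>
  The reference set is enumerated from zero, as \<open>y 0, \<dots>, y (n - 1)\<close>, to match the indexing of
  vectors and matrices.
\<close>

definition Omega :: "('a \<Rightarrow> 'b \<Rightarrow> real) \<Rightarrow> (nat \<Rightarrow> 'b) \<Rightarrow> nat \<Rightarrow> 'a \<Rightarrow> real" where
  "Omega \<alpha> y n x = (\<Sum>i<n. \<alpha> x (y i))"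

definition omega ::
    "'a measure \<Rightarrow> ('a \<Rightarrow> 'b \<Rightarrow> real) \<Rightarrow> (nat \<Rightarrow> 'b) \<Rightarrow> nat \<Rightarrow> 'b \<Rightarrow> real" where
  "omega \<mu> \<alpha> y n c = sqrt (\<integral>x. \<alpha> x c * Omega \<alpha> y n x \<partial>\<mu>)"

definition beta ::
    "'a measure \<Rightarrow> ('a \<Rightarrow> 'b \<Rightarrow> real) \<Rightarrow> (nat \<Rightarrow> 'b) \<Rightarrow> nat \<Rightarrow> 'a \<Rightarrow> 'b \<Rightarrow> real" where
  "beta \<mu> \<alpha> y n x c = \<alpha> x c / (Omega \<alpha> y n x * omega \<mu> \<alpha> y n c)"

definition p_kernel ::
    "'a measure \<Rightarrow> ('a \<Rightarrow> 'b \<Rightarrow> real) \<Rightarrow> (nat \<Rightarrow> 'b) \<Rightarrow> nat \<Rightarrow> 'a \<Rightarrow> 'a \<Rightarrow> real" where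
  "p_kernel \<mu> \<alpha> y n x x' = (\<Sum>i<n. beta \<mu> \<alpha> y n x (y i) * beta \<mu> \<alpha> y n x' (y i))"

definition weighted_measure ::
    "'a measure \<Rightarrow> ('a \<Rightarrow> 'b \<Rightarrow> real) \<Rightarrow> (nat \<Rightarrow> 'b) \<Rightarrow> nat \<Rightarrow> 'a measure" where
  "weighted_measure \<mu> \<alpha> y n = density \<mu> (\<lambda>x. ennreal ((Omega \<alpha> y n x)\<^sup>2))"

definition P_op ::
    "'a measure \<Rightarrow> ('a \<Rightarrow> 'b \<Rightarrow> real) \<Rightarrow> (nat \<Rightarrow> 'b) \<Rightarrow> nat \<Rightarrow> ('a \<Rightarrow> real) \<Rightarrow> 'a \<Rightarrow> real" where
  "P_op \<mu> \<alpha> y n f x = (\<integral>x'. p_kernel \<mu> \<alpha> y n x x' * f x' * (Omega \<alpha> y n x')\<^sup>2 \<partial>\<mu>)"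

definition A_mat ::
    "'a measure \<Rightarrow> ('a \<Rightarrow> 'b \<Rightarrow> real) \<Rightarrow> (nat \<Rightarrow> 'b) \<Rightarrow> nat \<Rightarrow> real mat" where
  "A_mat \<mu> \<alpha> y n = mat n n (\<lambda>(i, j).
     \<integral>x. beta \<mu> \<alpha> y n x (y i) * beta \<mu> \<alpha> y n x (y j) * (Omega \<alpha> y n x)\<^sup>2 \<partial>\<mu>)"

end

theory Submission
  imports Defs
begin

text \<open>
  Write \<open>M\<close> for the weighted measure and \<open>b i\<close> for the normalized affinity to the \<open>i\<close>-th reference
  point. The kernel is a finite sum of products, so the operator factors through finite dimension:
  \<open>P = S \<circ> S\<^sup>*\<close>, where the synthesis map \<open>S v = (\<Sum>i<n. b i * v $ i)\<close> takes coordinates to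
  functions and its adjoint, the analysis map \<open>S\<^sup>*\<close>, takes \<open>f\<close> to the vector of its inner products
  with the \<open>b i\<close>. Composed the other way round, \<open>S\<^sup>* \<circ> S\<close> is the matrix \<open>A\<close>, which is the Gram
  matrix of the family \<open>b\<close>.

  Everything follows from this. The products \<open>S S\<^sup>*\<close> and \<open>S\<^sup>* S\<close> have the same nonzero
  eigenvalues, because \<open>S\<^sup>*\<close> maps eigenfunctions of the first to eigenvectors of the second and \<open>S\<close>
  maps them back; neither map can send such an eigenvector to zero, since applying the other one
  recovers \<open>lam\<close> times the original. Moreover \<open>\<langle>f, P f\<rangle> = \<parallel>S\<^sup>* f\<parallel>\<^sup>2 \<ge> 0\<close>, so a nonzero eigenvalue is
  positive, and the square root that makes the correspondence between \<open>\<psi>\<close> and \<open>v\<close> symmetric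
  is a genuine one: \<open>v = S\<^sup>* \<psi> / sqrt lam\<close> and \<open>\<psi> = S v / sqrt lam\<close>.

  The argument is carried out for an arbitrary finite family in \<open>L\<^sup>2\<close> of an arbitrary measure
  (\<open>eigenvector_gram_mat_imp_eigenfunction\<close>, \<open>eigenfunction_imp_eigenvector_gram_mat\<close>). What is
  special to affinities is only that the \<open>b i\<close> belong to \<open>L\<^sup>2\<close> of the weighted measure
  (\<open>beta_in_L2_weighted\<close>): the factor \<open>1 / Omega\<close> in the normalization cancels the weight.
\<close>

section \<open>Square-integrable functions\<close>

lemma L2_measurable: "f \<in> L2 M \<Longrightarrow> f \<in> borel_measurable M"
  by (simp add: L2_def)

lemma L2_integrable_square: "f \<in> L2 M \<Longrightarrow> integrable M (\<lambda>x. (f x)\<^sup>2)"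
  by (simp add: L2_def)

lemma L2_integrable_mult:
  assumes "f \<in> L2 M" "g \<in> L2 M"
  shows "integrable M (\<lambda>x. f x * g x)"
proof (rule Bochner_Integration.integrable_bound)
  show "integrable M (\<lambda>x. (f x)\<^sup>2 + (g x)\<^sup>2)"
    using assms by (simp add: L2_integrable_square)
  show "(\<lambda>x. f x * g x) \<in> borel_measurable M"
    using assms by (intro borel_measurable_times L2_measurable)
  have "\<bar>a * b\<bar> \<le> a\<^sup>2 + b\<^sup>2" for a b :: real
    using sum_squares_bound[of "\<bar>a\<bar>" "\<bar>b\<bar>"] abs_ge_zero[of "a * b"]
    unfolding abs_mult power2_abs by linarith
  then show "AE x in M. norm (f x * g x) \<le> norm ((f x)\<^sup>2 + (g x)\<^sup>2)"
    by simp
qed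

lemma L2_add:
  assumes "f \<in> L2 M" "g \<in> L2 M"
  shows "(\<lambda>x. f x + g x) \<in> L2 M"
proof -
  have "integrable M (\<lambda>x. (f x)\<^sup>2 + (g x)\<^sup>2 + 2 * (f x * g x))"
    using assms by (simp add: L2_integrable_square L2_integrable_mult)
  then show ?thesis
    using assms by (auto simp: L2_def power2_sum mult.assoc intro: borel_measurable_add)
qed

lemma L2_mult_const:
  assumes "f \<in> L2 M"
  shows "(\<lambda>x. f x * c) \<in> L2 M"
  using assms by (auto simp: L2_def power_mult_distrib intro: borel_measurable_times)

lemma L2_sum:
  assumes "\<And>i. i \<in> I \<Longrightarrow> f i \<in> L2 M"
  shows "(\<lambda>x. \<Sum>i\<in>I. f i x) \<in> L2 M"
  using assms
proof (induction I rule: infinite_finite_induct)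
  case (insert j I)
  then show ?case by (simp add: L2_add)
qed (simp_all add: L2_def)

section \<open>Synthesis and analysis for a finite family\<close>

definition synthesis :: "(nat \<Rightarrow> 'a \<Rightarrow> real) \<Rightarrow> nat \<Rightarrow> real vec \<Rightarrow> 'a \<Rightarrow> real" where
  "synthesis b n v x = (\<Sum>i<n. b i x * v $ i)"

definition analysis ::
    "'a measure \<Rightarrow> (nat \<Rightarrow> 'a \<Rightarrow> real) \<Rightarrow> nat \<Rightarrow> ('a \<Rightarrow> real) \<Rightarrow> real vec" where
  "analysis M b n f = vec n (\<lambda>i. \<integral>x. b i x * f x \<partial>M)"

definition gram_mat :: "'a measure \<Rightarrow> (nat \<Rightarrow> 'a \<Rightarrow> real) \<Rightarrow> nat \<Rightarrow> real mat" where
  "gram_mat M b n = mat n n (\<lambda>(i, j). \<integral>x. b i x * b j x \<partial>M)"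

definition frame_op ::
    "'a measure \<Rightarrow> (nat \<Rightarrow> 'a \<Rightarrow> real) \<Rightarrow> nat \<Rightarrow> ('a \<Rightarrow> real) \<Rightarrow> 'a \<Rightarrow> real" where
  "frame_op M b n f = synthesis b n (analysis M b n f)"

lemma analysis_in_carrier [simp]: "analysis M b n f \<in> carrier_vec n"
  by (simp add: analysis_def)

lemma synthesis_in_L2:
  assumes "\<And>i. i < n \<Longrightarrow> b i \<in> L2 M"
  shows "synthesis b n v \<in> L2 M"
  unfolding synthesis_def using assms by (intro L2_sum L2_mult_const) auto

lemma synthesis_smult:
  assumes "v \<in> carrier_vec n"
  shows "synthesis b n (c \<cdot>\<^sub>v v) x = c * synthesis b n v x"
  using assms by (simp add: synthesis_def sum_distrib_left mult.left_commute)

lemma synthesis_zero: "synthesis b n (0\<^sub>v n) x = 0"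
  by (simp add: synthesis_def)

text \<open>
  The analysis map is defined by integrals, so it only sees the almost-everywhere class; this is what
  lets eigenvalue equations that hold almost everywhere be transported to \<open>\<real>\<^sup>n\<close>.
\<close>

lemma analysis_AE_scale:
  assumes "\<And>i. i < n \<Longrightarrow> b i \<in> L2 M" and "f \<in> L2 M" and "g \<in> L2 M"
    and "AE x in M. g x = c * f x"
  shows "analysis M b n g = c \<cdot>\<^sub>v analysis M b n f"
proof (rule eq_vecI)
  fix i assume "i < dim_vec (c \<cdot>\<^sub>v analysis M b n f)"
  then have i: "i < n" by (simp add: analysis_def)
  have "(\<integral>x. b i x * g x \<partial>M) = (\<integral>x. c * (b i x * f x) \<partial>M)"
    using assms i
    by (intro integral_cong_AE)
      (auto intro!: borel_measurable_times borel_measurable_const intro: L2_measurable)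
  then show "analysis M b n g $ i = (c \<cdot>\<^sub>v analysis M b n f) $ i"
    using i by (simp add: analysis_def)
qed (simp add: analysis_def)

lemma analysis_synthesis:
  assumes b: "\<And>i. i < n \<Longrightarrow> b i \<in> L2 M" and v: "v \<in> carrier_vec n"
  shows "analysis M b n (synthesis b n v) = gram_mat M b n *\<^sub>v v"
proof (rule eq_vecI)
  fix i assume "i < dim_vec (gram_mat M b n *\<^sub>v v)"
  then have i: "i < n" by (simp add: gram_mat_def)
  have int: "integrable M (\<lambda>x. b i x * b j x)" if "j < n" for j
    using b i that by (simp add: L2_integrable_mult)
  have "(\<integral>x. b i x * synthesis b n v x \<partial>M) = (\<integral>x. (\<Sum>j<n. b i x * b j x * v $ j) \<partial>M)"
    by (simp add: synthesis_def sum_distrib_left mult.assoc)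
  also have "\<dots> = (\<Sum>j<n. (\<integral>x. b i x * b j x \<partial>M) * v $ j)"
    using int by (subst Bochner_Integration.integral_sum) auto
  finally show "analysis M b n (synthesis b n v) $ i = (gram_mat M b n *\<^sub>v v) $ i"
    using i v by (simp add: analysis_def gram_mat_def scalar_prod_def atLeast0LessThan)
qed (simp add: analysis_def gram_mat_def)

text \<open>
  Positivity of \<open>S S\<^sup>*\<close>: the quadratic form \<open>\<langle>f, S S\<^sup>* f\<rangle>\<close> is the squared length of \<open>S\<^sup>* f\<close>.
\<close>

lemma integral_mult_frame_op:
  assumes b: "\<And>i. i < n \<Longrightarrow> b i \<in> L2 M" and f: "f \<in> L2 M"
  shows "(\<integral>x. f x * frame_op M b n f x \<partial>M) = (\<Sum>i<n. (analysis M b n f $ i)\<^sup>2)"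
proof -
  have int: "integrable M (\<lambda>x. b i x * f x)" if "i < n" for i
    using b f that by (simp add: L2_integrable_mult)
  have "(\<integral>x. f x * frame_op M b n f x \<partial>M)
      = (\<integral>x. (\<Sum>i<n. b i x * f x * analysis M b n f $ i) \<partial>M)"
    by (simp add: frame_op_def synthesis_def sum_distrib_left ac_simps)
  also have "\<dots> = (\<Sum>i<n. (\<integral>x. b i x * f x \<partial>M) * analysis M b n f $ i)"
    using int by (subst Bochner_Integration.integral_sum) auto
  also have "\<dots> = (\<Sum>i<n. (analysis M b n f $ i)\<^sup>2)"
    by (simp add: analysis_def power2_eq_square)
  finally show ?thesis .
qed

section \<open>The spectral correspondence\<close>

text \<open>
  If \<open>S\<^sup>* S v = lam v\<close>, then \<open>S S\<^sup>* (S v) = lam (S v)\<close>; and \<open>S v\<close> is nonzero because \<open>S\<^sup>*\<close> maps it to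
  \<open>lam v \<noteq> 0\<close>.
\<close>

lemma eigenvector_gram_mat_imp_eigenfunction:
  assumes b: "\<And>i. i < n \<Longrightarrow> b i \<in> L2 M" and lam: "lam \<noteq> 0"
    and v: "eigenvector (gram_mat M b n) v lam"
  shows "L2_eigenfunction M (frame_op M b n) (synthesis b n v) lam"
proof -
  have carrier: "v \<in> carrier_vec n" and nonzero: "v \<noteq> 0\<^sub>v n"
    and eig: "gram_mat M b n *\<^sub>v v = lam \<cdot>\<^sub>v v"
    using v by (auto simp: eigenvector_def gram_mat_def)
  have ana: "analysis M b n (synthesis b n v) = lam \<cdot>\<^sub>v v"
    using analysis_synthesis[OF b carrier] eig by simp
  have synth_L2: "synthesis b n v \<in> L2 M"
    using b by (rule synthesis_in_L2)
  have "\<not> (AE x in M. synthesis b n v x = 0)"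
  proof
    assume "AE x in M. synthesis b n v x = 0"
    then have "analysis M b n (synthesis b n v) = 0 \<cdot>\<^sub>v analysis M b n (synthesis b n v)"
      using b synth_L2 by (intro analysis_AE_scale) auto
    with ana carrier have "lam \<cdot>\<^sub>v v = 0\<^sub>v n"
      by (auto simp: smult_vec_def zero_vec_def)
    moreover have "v = (1 / lam) \<cdot>\<^sub>v (lam \<cdot>\<^sub>v v)"
      using lam by (simp add: smult_smult_assoc)
    ultimately have "v = (1 / lam) \<cdot>\<^sub>v 0\<^sub>v n"
      by simp
    then show False
      using nonzero by auto
  qed
  then show ?thesis
    using synth_L2 ana carrier by (simp add: L2_eigenfunction_def frame_op_def synthesis_smult)
qed

lemma nonzero_L2_imp_square_integral_pos:
  assumes "f \<in> L2 M" and "\<not> (AE x in M. f x = 0)"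
  shows "0 < (\<integral>x. (f x)\<^sup>2 \<partial>M)"
proof -
  have "(\<integral>x. (f x)\<^sup>2 \<partial>M) \<noteq> 0"
    using assms integral_nonneg_eq_0_iff_AE[OF L2_integrable_square[OF assms(1)]] by simp
  moreover have "0 \<le> (\<integral>x. (f x)\<^sup>2 \<partial>M)"
    by simp
  ultimately show ?thesis
    by linarith
qed

lemma eigenfunction_frame_op_imp_eigenvalue_pos:
  assumes b: "\<And>i. i < n \<Longrightarrow> b i \<in> L2 M" and lam: "lam \<noteq> 0"
    and f: "L2_eigenfunction M (frame_op M b n) f lam"
  shows "0 < lam"
proof -
  have L2: "f \<in> L2 M" and nonzero: "\<not> (AE x in M. f x = 0)"
    and eig: "AE x in M. frame_op M b n f x = lam * f x"
    using f by (auto simp: L2_eigenfunction_def)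
  have "frame_op M b n f \<in> L2 M"
    unfolding frame_op_def using b by (rule synthesis_in_L2)
  then have "(\<integral>x. f x * frame_op M b n f x \<partial>M) = (\<integral>x. lam * (f x)\<^sup>2 \<partial>M)"
    using L2 eig by (intro integral_cong_AE) (auto simp: power2_eq_square intro!: borel_measurable_times borel_measurable_const
      intro: L2_measurable)
  then have "lam * (\<integral>x. (f x)\<^sup>2 \<partial>M) = (\<Sum>i<n. (analysis M b n f $ i)\<^sup>2)"
    using integral_mult_frame_op[OF b L2] by simp
  then have "0 \<le> lam * (\<integral>x. (f x)\<^sup>2 \<partial>M)"
    by (simp add: sum_nonneg)
  with nonzero_L2_imp_square_integral_pos[OF L2 nonzero] lam show ?thesis
    by (simp add: zero_le_mult_iff)
qed

text \<open>
  If \<open>S S\<^sup>* f = lam f\<close>, then \<open>S\<^sup>* S (S\<^sup>* f) = lam (S\<^sup>* f)\<close>; and \<open>S\<^sup>* f\<close> is nonzero because \<open>S\<close> maps it to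
  \<open>lam f \<noteq> 0\<close>. Dividing by \<open>sqrt lam\<close> is harmless for the eigenvector property and splits the factor
  \<open>lam\<close> of \<open>S (S\<^sup>* f) = lam f\<close> evenly between the two directions.
\<close>

lemma eigenfunction_imp_eigenvector_gram_mat:
  assumes b: "\<And>i. i < n \<Longrightarrow> b i \<in> L2 M" and lam: "lam \<noteq> 0"
    and f: "L2_eigenfunction M (frame_op M b n) f lam"
  defines "v \<equiv> (1 / sqrt lam) \<cdot>\<^sub>v analysis M b n f"
  shows "eigenvector (gram_mat M b n) v lam"
    and "AE x in M. f x = 1 / sqrt lam * synthesis b n v x"
proof -
  have L2: "f \<in> L2 M" and nonzero: "\<not> (AE x in M. f x = 0)"
    and eig: "AE x in M. frame_op M b n f x = lam * f x"
    using f by (auto simp: L2_eigenfunction_def)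
  have pos: "0 < lam"
    using b lam f by (rule eigenfunction_frame_op_imp_eigenvalue_pos)
  have carrier: "v \<in> carrier_vec n"
    by (simp add: v_def)
  have synth_v: "synthesis b n v x = 1 / sqrt lam * frame_op M b n f x" for x
    unfolding v_def frame_op_def by (rule synthesis_smult) simp
  show recover: "AE x in M. f x = 1 / sqrt lam * synthesis b n v x"
    using eig
  proof eventually_elim
    case (elim x)
    with pos show ?case
      by (simp add: synth_v)
  qed
  have "synthesis b n v \<in> L2 M"
    using b by (rule synthesis_in_L2)
  moreover have "AE x in M. synthesis b n v x = sqrt lam * f x"
    using recover by eventually_elim (use pos in simp)
  ultimately have "analysis M b n (synthesis b n v) = sqrt lam \<cdot>\<^sub>v analysis M b n f"
    using b L2 by (intro analysis_AE_scale) auto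
  moreover have "sqrt lam \<cdot>\<^sub>v analysis M b n f = lam \<cdot>\<^sub>v v"
    using pos by (simp add: v_def smult_smult_assoc real_div_sqrt)
  ultimately have "gram_mat M b n *\<^sub>v v = lam \<cdot>\<^sub>v v"
    using analysis_synthesis[OF b carrier] by simp
  moreover have "v \<noteq> 0\<^sub>v n"
    using recover nonzero by (auto simp: synthesis_zero)
  ultimately show "eigenvector (gram_mat M b n) v lam"
    using carrier by (simp add: eigenvector_def gram_mat_def)
qed

section \<open>Normalized affinities\<close>

lemma Omega_measurable:
  assumes "\<And>i. i < n \<Longrightarrow> (\<lambda>x. \<alpha> x (y i)) \<in> borel_measurable \<mu>"
  shows "Omega \<alpha> y n \<in> borel_measurable \<mu>"
  unfolding Omega_def using assms by auto

lemma beta_measurable: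
  assumes "\<And>i. i < n \<Longrightarrow> (\<lambda>x. \<alpha> x (y i)) \<in> borel_measurable \<mu>" and "i < n"
  shows "(\<lambda>x. beta \<mu> \<alpha> y n x (y i)) \<in> borel_measurable \<mu>"
  unfolding beta_def using assms Omega_measurable[where \<alpha> = \<alpha> and y = y, OF assms(1)] by auto

lemma integral_weighted_measure:
  assumes "Omega \<alpha> y n \<in> borel_measurable \<mu>" and "g \<in> borel_measurable \<mu>"
  shows "(\<integral>x. g x \<partial>weighted_measure \<mu> \<alpha> y n) = (\<integral>x. g x * (Omega \<alpha> y n x)\<^sup>2 \<partial>\<mu>)"
  unfolding weighted_measure_def using assms
  by (subst integral_density) (auto simp: mult.commute)

text \<open>
  The weight cancels the first factor of the normalization:
  \<open>beta\<^sup>2 * Omega\<^sup>2 = \<alpha>\<^sup>2 / omega\<^sup>2\<close>, and \<open>\<alpha>\<^sup>2\<close> is integrable.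
\<close>

lemma beta_in_L2_weighted:
  assumes L2: "\<And>i. i < n \<Longrightarrow> (\<lambda>x. \<alpha> x (y i)) \<in> L2 \<mu>"
    and Omega_pos: "\<And>x. x \<in> space \<mu> \<Longrightarrow> 0 < Omega \<alpha> y n x"
    and i: "i < n"
  shows "(\<lambda>x. beta \<mu> \<alpha> y n x (y i)) \<in> L2 (weighted_measure \<mu> \<alpha> y n)"
proof -
  have meas: "(\<lambda>x. \<alpha> x (y j)) \<in> borel_measurable \<mu>" if "j < n" for j
    using L2[OF that] by (rule L2_measurable)
  have [measurable]: "Omega \<alpha> y n \<in> borel_measurable \<mu>"
    using meas by (rule Omega_measurable)
  have [measurable]: "(\<lambda>x. beta \<mu> \<alpha> y n x (y i)) \<in> borel_measurable \<mu>"
    using meas i by (rule beta_measurable)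
  have "integrable \<mu> (\<lambda>x. (\<alpha> x (y i))\<^sup>2 / (omega \<mu> \<alpha> y n (y i))\<^sup>2)"
    using L2_integrable_square[OF L2[OF i]] by simp
  also have "?this \<longleftrightarrow> integrable \<mu> (\<lambda>x. (Omega \<alpha> y n x)\<^sup>2 * (beta \<mu> \<alpha> y n x (y i))\<^sup>2)"
  proof (rule Bochner_Integration.integrable_cong[OF refl])
    fix x assume "x \<in> space \<mu>"
    then have "Omega \<alpha> y n x \<noteq> 0"
      using Omega_pos by force
    then show "(\<alpha> x (y i))\<^sup>2 / (omega \<mu> \<alpha> y n (y i))\<^sup>2
        = (Omega \<alpha> y n x)\<^sup>2 * (beta \<mu> \<alpha> y n x (y i))\<^sup>2"
      by (simp add: beta_def power_divide power_mult_distrib)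
  qed
  finally show ?thesis
    by (simp add: L2_def weighted_measure_def integrable_density)
qed

lemma A_mat_eq_gram_mat:
  assumes "\<And>i. i < n \<Longrightarrow> (\<lambda>x. \<alpha> x (y i)) \<in> borel_measurable \<mu>"
  shows "A_mat \<mu> \<alpha> y n = gram_mat (weighted_measure \<mu> \<alpha> y n) (\<lambda>i x. beta \<mu> \<alpha> y n x (y i)) n"
proof -
  have "Omega \<alpha> y n \<in> borel_measurable \<mu>"
    using assms by (rule Omega_measurable)
  moreover have "(\<lambda>x. beta \<mu> \<alpha> y n x (y i)) \<in> borel_measurable \<mu>" if "i < n" for i
    using assms that by (rule beta_measurable)
  ultimately show ?thesis
    unfolding A_mat_def gram_mat_def
    by (intro cong_mat) (auto simp: integral_weighted_measure borel_measurable_times)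
qed

lemma P_op_eq_frame_op:
  assumes meas: "\<And>i. i < n \<Longrightarrow> (\<lambda>x. \<alpha> x (y i)) \<in> borel_measurable \<mu>"
    and beta_L2: "\<And>i. i < n \<Longrightarrow> (\<lambda>x. beta \<mu> \<alpha> y n x (y i)) \<in> L2 (weighted_measure \<mu> \<alpha> y n)"
    and f: "f \<in> L2 (weighted_measure \<mu> \<alpha> y n)"
  shows "P_op \<mu> \<alpha> y n f x
    = frame_op (weighted_measure \<mu> \<alpha> y n) (\<lambda>i x. beta \<mu> \<alpha> y n x (y i)) n f x"
proof -
  let ?M = "weighted_measure \<mu> \<alpha> y n" and ?b = "\<lambda>i x. beta \<mu> \<alpha> y n x (y i)"
  have f_meas: "f \<in> borel_measurable \<mu>"
    using L2_measurable[OF f] by (simp add: weighted_measure_def)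
  have Omega_meas: "Omega \<alpha> y n \<in> borel_measurable \<mu>"
    using meas by (rule Omega_measurable)
  have beta_meas: "?b i \<in> borel_measurable \<mu>" if "i < n" for i
    using meas that by (rule beta_measurable)
  have kernel_meas: "(\<lambda>x'. p_kernel \<mu> \<alpha> y n x x' * f x') \<in> borel_measurable \<mu>"
    unfolding p_kernel_def using f_meas beta_meas
    by (intro borel_measurable_times borel_measurable_sum borel_measurable_const) auto
  have "P_op \<mu> \<alpha> y n f x = (\<integral>x'. p_kernel \<mu> \<alpha> y n x x' * f x' \<partial>?M)"
    unfolding P_op_def using Omega_meas kernel_meas
    by (rule integral_weighted_measure[symmetric])
  also have "\<dots> = (\<integral>x'. (\<Sum>i<n. ?b i x * (?b i x' * f x')) \<partial>?M)"
    by (simp add: p_kernel_def sum_distrib_right mult.assoc)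
  also have "\<dots> = (\<Sum>i<n. ?b i x * (\<integral>x'. ?b i x' * f x' \<partial>?M))"
    using f beta_L2
    by (subst Bochner_Integration.integral_sum) (auto intro: L2_integrable_mult)
  also have "\<dots> = frame_op ?M ?b n f x"
    by (simp add: frame_op_def synthesis_def analysis_def)
  finally show ?thesis .
qed

theorem proposition3:
  fixes \<mu> :: "'a measure" and Y :: "'b set" and y :: "nat \<Rightarrow> 'b" and n :: nat
    and \<alpha> :: "'a \<Rightarrow> 'b \<Rightarrow> real"
  assumes enum: "bij_betw y {..<n} Y"
    and pos: "\<And>x c. x \<in> space \<mu> \<Longrightarrow> c \<in> Y \<Longrightarrow> 0 < \<alpha> x c"
    and L2: "\<And>c. c \<in> Y \<Longrightarrow> (\<lambda>x. \<alpha> x c) \<in> L2 \<mu>"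
    and Omega_pos: "\<And>x. x \<in> space \<mu> \<Longrightarrow> 0 < Omega \<alpha> y n x"
    and omega_finite: "\<And>c. c \<in> Y \<Longrightarrow> integrable \<mu> (\<lambda>x. \<alpha> x c * Omega \<alpha> y n x)"
    and omega_pos: "\<And>c. c \<in> Y \<Longrightarrow> 0 < omega \<mu> \<alpha> y n c"
  shows "(\<forall>lam::real. lam \<noteq> 0 \<longrightarrow>
           (L2_eigenvalue (weighted_measure \<mu> \<alpha> y n) (P_op \<mu> \<alpha> y n) lam
              \<longleftrightarrow> eigenvalue (A_mat \<mu> \<alpha> y n) lam)) \<and>
         (\<forall>(lam::real) \<psi>. lam \<noteq> 0 \<longrightarrow>
           L2_eigenfunction (weighted_measure \<mu> \<alpha> y n) (P_op \<mu> \<alpha> y n) \<psi> lam \<longrightarrow>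
           0 < lam \<and>
           (\<exists>v. eigenvector (A_mat \<mu> \<alpha> y n) v lam \<and>
             (AE x in weighted_measure \<mu> \<alpha> y n.
                \<psi> x = 1 / sqrt lam * (\<Sum>i<n. beta \<mu> \<alpha> y n x (y i) * v $ i)) \<and>
             (\<forall>i<n. v $ i =
                1 / sqrt lam * (\<integral>x. beta \<mu> \<alpha> y n x (y i) * \<psi> x * (Omega \<alpha> y n x)\<^sup>2 \<partial>\<mu>))))"
proof -
  let ?M = "weighted_measure \<mu> \<alpha> y n" and ?b = "\<lambda>i x. beta \<mu> \<alpha> y n x (y i)"
  have in_Y: "y i \<in> Y" if "i < n" for i
    using enum that by (auto simp: bij_betw_def)
  have alpha_L2: "(\<lambda>x. \<alpha> x (y i)) \<in> L2 \<mu>" if "i < n" for i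
    using L2 in_Y that by blast
  have alpha_meas: "(\<lambda>x. \<alpha> x (y i)) \<in> borel_measurable \<mu>" if "i < n" for i
    using alpha_L2[OF that] by (rule L2_measurable)
  have beta_L2: "?b i \<in> L2 ?M" if "i < n" for i
    using alpha_L2 Omega_pos that by (rule beta_in_L2_weighted)
  have A: "A_mat \<mu> \<alpha> y n = gram_mat ?M ?b n"
    using alpha_meas by (rule A_mat_eq_gram_mat)
  have P: "L2_eigenfunction ?M (P_op \<mu> \<alpha> y n) f lam \<longleftrightarrow> L2_eigenfunction ?M (frame_op ?M ?b n) f lam"
    for f lam
    using P_op_eq_frame_op[where \<alpha> = \<alpha> and y = y, OF alpha_meas beta_L2]
    by (auto simp: L2_eigenfunction_def)
  show ?thesis
  proof (intro conjI allI impI)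
    fix lam :: real assume lam: "lam \<noteq> 0"
    show "L2_eigenvalue ?M (P_op \<mu> \<alpha> y n) lam \<longleftrightarrow> eigenvalue (A_mat \<mu> \<alpha> y n) lam"
      unfolding L2_eigenvalue_def eigenvalue_def A P
      using eigenvector_gram_mat_imp_eigenfunction[where b = ?b, OF beta_L2 lam]
        eigenfunction_imp_eigenvector_gram_mat(1)[where b = ?b, OF beta_L2 lam] by blast
  next
    fix lam :: real and \<psi>
    assume lam: "lam \<noteq> 0" and "L2_eigenfunction ?M (P_op \<mu> \<alpha> y n) \<psi> lam"
    then have psi: "L2_eigenfunction ?M (frame_op ?M ?b n) \<psi> lam"
      by (simp add: P)
    show "0 < lam"
      using beta_L2 lam psi by (rule eigenfunction_frame_op_imp_eigenvalue_pos)
    let ?v = "(1 / sqrt lam) \<cdot>\<^sub>v analysis ?M ?b n \<psi>"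
    have psi_meas: "\<psi> \<in> borel_measurable \<mu>"
      using psi by (simp add: L2_eigenfunction_def L2_def weighted_measure_def)
    have Omega_meas: "Omega \<alpha> y n \<in> borel_measurable \<mu>"
      using alpha_meas by (rule Omega_measurable)
    have beta_meas: "?b i \<in> borel_measurable \<mu>" if "i < n" for i
      using alpha_meas that by (rule beta_measurable)
    have "?v $ i = 1 / sqrt lam * (\<integral>x. ?b i x * \<psi> x * (Omega \<alpha> y n x)\<^sup>2 \<partial>\<mu>)" if "i < n" for i
      using that psi_meas beta_meas Omega_meas
      by (simp add: analysis_def integral_weighted_measure borel_measurable_times)
    then show "\<exists>v. eigenvector (A_mat \<mu> \<alpha> y n) v lam \<and>
        (AE x in ?M. \<psi> x = 1 / sqrt lam * (\<Sum>i<n. ?b i x * v $ i)) \<and>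
        (\<forall>i<n. v $ i = 1 / sqrt lam * (\<integral>x. ?b i x * \<psi> x * (Omega \<alpha> y n x)\<^sup>2 \<partial>\<mu>))"
      using eigenfunction_imp_eigenvector_gram_mat[where b = ?b, OF beta_L2 lam psi]
      unfolding A synthesis_def by blast
  qed
qed

end
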